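(* Let $n\ge1$, $\sigma_0^2>0$ and $Q_0=\mathcal N(0,\sigma_0^2I_n)$. Let $R^n=(R_1,\dots,R_n)$ be any zero-mean real random vector with finite second moments and coordinate variances $\operatorname{Var}(R_t)=\sigma_0^2+P_t$, $t=1,\dots,n$, where $P_t\ge0$. Define $\rho_t=P_t/\sigma_0^2$. Then $$D(P_{R^n}\|Q_0)\ge\frac12\sum_{t=1}^n\big(\rho_t-\ln(1+\rho_t)\big).$$ Equality is attained when the coordinates of $R^n$ are independent Gaussian random variables with $R_t\sim\mathcal N(0,\sigma_0^2+P_t)$.
   Context: $P_{R^n}$ denotes the law of $R^n$, $I_n$ the $n\times n$ identity matrix. Relative entropy (natural logarithm): $D(P\|Q)=\int\log\frac{dP}{dQ}\,dP$ if $P$ is absolutely continuous with respect to $Q$, and $D(P\|Q)=+\infty$ otherwise. *)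

theory Defs
  imports "HOL-Probability.Probability"
begin

text \<open>
  Extended-real relative entropy D(P || Q) in nats, for measures P and Q on the same
  sigma-algebra.  The library's \<open>KL_divergence\<close> is a real-valued Bochner integral, hence 0 when
  the log-likelihood ratio is not integrable, and it ignores absolute continuity.  Note that
  \<open>ennreal\<close> sends negative reals to 0, so the two integrals below are those of the positive
  and the negative part of log (dP/dQ).  For probability measures the second one is always finite.
\<close>

definition rel_entropy :: "'a measure \<Rightarrow> 'a measure \<Rightarrow> ereal" where
  "rel_entropy P Q =
     (if absolutely_continuous Q P
      then enn2ereal (\<integral>\<^sup>+x. ennreal (entropy_density (exp 1) Q P x) \<partial>P)
         - enn2ereal (\<integral>\<^sup>+x. ennreal (- entropy_density (exp 1) Q P x) \<partial>P)
      else \<infinity>)"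

text \<open>The law \<open>N(m, C)\<close>, meaningful for symmetric positive definite \<open>C\<close>.\<close>

definition gaussian :: "real ^ 'n \<Rightarrow> real ^ 'n ^ 'n \<Rightarrow> (real ^ 'n) measure" where
  "gaussian m C = density lborel
     (\<lambda>x. ennreal (exp (- ((x - m) \<bullet> (matrix_inv C *v (x - m))) / 2)
                     / sqrt ((2 * pi) ^ CARD('n) * det C)))"

end

theory Submission
  imports Defs
begin

text \<open>
  For an exponent \<open>L\<close> with \<open>\<integral>exp L \<partial>Q \<le> 1\<close>, the Gibbs inequality gives
  \<open>D(P || Q) \<ge> \<integral>L \<partial>P\<close>, with equality if \<open>exp L\<close> is the density of \<open>P\<close> with respect to \<open>Q\<close>.
  Take for \<open>L\<close> the log-likelihood ratio of the centred Gaussian product law with variances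
  \<open>\<sigma>\<^sub>0\<^sup>2 + P\<^sub>t\<close> against \<open>Q\<^sub>0\<close>.  It is an affine function of the squares
  of the coordinates, so its integral depends on the variances of \<open>R\<close> alone, and it equals the
  claimed bound.
\<close>

section \<open>The Gibbs inequality for the extended relative entropy\<close>

text \<open>Integrability makes the positive and negative parts both finite, so their extended
  difference is the Bochner integral.\<close>

lemma rel_entropy_eq_integral:
  assumes "absolutely_continuous Q P" and "integrable P (entropy_density (exp 1) Q P)"
  shows "rel_entropy P Q = ereal (\<integral>x. entropy_density (exp 1) Q P x \<partial>P)"
proof -
  let ?D = "entropy_density (exp 1) Q P"
  have fin: "(\<integral>\<^sup>+x. ennreal (?D x) \<partial>P) \<noteq> \<infinity>" "(\<integral>\<^sup>+x. ennreal (- ?D x) \<partial>P) \<noteq> \<infinity>"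
    using assms(2) by (auto simp: real_integrable_def)
  have enn: "enn2ereal a = ereal (enn2real a)" if "a \<noteq> \<infinity>" for a
    using that by (cases a) auto
  show ?thesis
    using assms fin unfolding rel_entropy_def
    by (simp add: enn real_lebesgue_integral_def)
qed

text \<open>Radon-Nikodym derivatives are unique \<open>Q\<close>-almost everywhere, and
  \<open>P\<close>, having a density over \<open>Q\<close>, inherits the null sets of
  \<open>Q\<close>.\<close>

lemma entropy_density_exp_density:
  assumes "sigma_finite_measure Q" and [measurable]: "L \<in> borel_measurable Q"
    and P: "P = density Q (\<lambda>x. ennreal (exp (L x)))"
  shows "AE x in P. entropy_density (exp 1) Q P x = L x"
proof -
  interpret Q: sigma_finite_measure Q by fact
  have "AE x in Q. ennreal (exp (L x)) = RN_deriv Q P x"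
    by (rule Q.RN_deriv_unique) (auto simp: P)
  then have "AE x in Q. entropy_density (exp 1) Q P x = L x"
    by eventually_elim (drule sym, simp add: entropy_density_def log_def)
  then show ?thesis
    unfolding P by (subst AE_density) auto
qed

lemma rel_entropy_exp_density:
  assumes Q: "sigma_finite_measure Q" and L[measurable]: "L \<in> borel_measurable Q"
    and P: "P = density Q (\<lambda>x. ennreal (exp (L x)))"
    and int: "integrable P L"
  shows "rel_entropy P Q = ereal (\<integral>x. L x \<partial>P)"
proof -
  have sets[measurable_cong]: "sets P = sets Q" by (simp add: P)
  have ac: "absolutely_continuous Q P"
    unfolding P by (rule absolutely_continuousI_density) measurable
  have AE: "AE x in P. entropy_density (exp 1) Q P x = L x"
    by (rule entropy_density_exp_density[OF Q L P])
  have [measurable]: "entropy_density (exp 1) Q P \<in> borel_measurable P"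
    using measurable_entropy_density[of "exp 1" Q P] sets
    by (simp cong: measurable_cong_sets)
  have [measurable]: "L \<in> borel_measurable P"
    using int by auto
  have "integrable P (entropy_density (exp 1) Q P)"
    using int by (subst integrable_cong_AE[OF _ _ AE]) auto
  then show ?thesis
    using ac AE by (subst rel_entropy_eq_integral) (auto intro: integral_cong_AE)
qed

text \<open>Apply \<open>ln w \<le> w - 1\<close> to w = \<open>exp L\<close> / (dP/dQ). This yields
  L + 1 - w \<le> log (dP/dQ) almost everywhere under \<open>P\<close>, and w has
  \<open>P\<close>-integral at most that of \<open>exp L\<close> under \<open>Q\<close>, hence at
  most 1.\<close>

lemma rel_entropy_ge_integral:
  assumes Q: "sigma_finite_measure Q" and P: "prob_space P" and sets: "sets P = sets Q"
    and le1: "(\<integral>\<^sup>+x. ennreal (exp (L x)) \<partial>Q) \<le> 1"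
    and int: "integrable P L"
  shows "rel_entropy P Q \<ge> ereal (\<integral>x. L x \<partial>P)"
proof (cases "absolutely_continuous Q P")
  case False
  then show ?thesis by (simp add: rel_entropy_def)
next
  case ac: True
  interpret Q: sigma_finite_measure Q by fact
  interpret P: prob_space P by fact
  note [measurable_cong] = sets
  have [measurable]: "L \<in> borel_measurable Q"
    using int sets by (auto cong: measurable_cong_sets)
  define f where "f = RN_deriv Q P"
  define h where "h x = enn2real (f x)" for x
  define D where "D = entropy_density (exp 1) Q P"
  \<comment> \<open>Division by zero makes \<open>W\<close> vanish where \<open>h\<close> does, so
    \<open>h * W\<close> may fall below \<open>exp L\<close> there. Only the upper bound on the
    integral of \<open>W\<close> matters.\<close>
  define W where "W x = exp (L x) / h x" for x
  define B where "B x = L x + 1 - W x" for x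
  have [measurable]: "f \<in> borel_measurable Q" by (simp add: f_def)
  have [measurable]: "h \<in> borel_measurable Q" unfolding h_def by measurable
  have [measurable]: "D \<in> borel_measurable Q" unfolding D_def by measurable
  have [measurable]: "W \<in> borel_measurable Q" unfolding W_def by measurable
  have [measurable]: "B \<in> borel_measurable Q" unfolding B_def by measurable
  have dens: "P = density Q f"
    unfolding f_def by (rule Q.density_RN_deriv[symmetric]) (use ac sets in auto)
  have fin: "AE x in Q. f x = ennreal (h x)"
    using Q.RN_deriv_finite[OF P.sigma_finite_measure_axioms ac sets]
    by eventually_elim (simp add: f_def h_def top.not_eq_extremum)
  \<comment> \<open>The zero set of the density \<open>f\<close> is null for
    \<open>P\<close>.\<close>
  then have pos: "AE x in P. 0 < h x"
    unfolding dens by (subst AE_density) auto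
  have W0: "0 \<le> W x" for x by (simp add: W_def h_def)
  have "AE x in Q. f x * ennreal (W x) \<le> ennreal (exp (L x))"
    using fin
  proof eventually_elim
    case (elim x)
    have "h x * W x \<le> exp (L x)" by (simp add: W_def)
    then show ?case
      unfolding elim using W0[of x] by (simp add: h_def ennreal_leI flip: ennreal_mult)
  qed
  moreover have "(\<integral>\<^sup>+x. ennreal (W x) \<partial>P) = (\<integral>\<^sup>+x. f x * ennreal (W x) \<partial>Q)"
    unfolding dens by (rule nn_integral_density) measurable
  ultimately have "(\<integral>\<^sup>+x. ennreal (W x) \<partial>P) \<le> (\<integral>\<^sup>+x. ennreal (exp (L x)) \<partial>Q)"
    by (simp add: nn_integral_mono_AE)
  with le1 have W1: "(\<integral>\<^sup>+x. ennreal (W x) \<partial>P) \<le> 1" by (rule order_trans[rotated])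
  have intW: "integrable P W"
    using W1 W0 by (intro integrableI_nonneg) (auto simp: order.strict_iff_order top_unique)
  have W2: "(\<integral>x. W x \<partial>P) \<le> 1"
    using W1 nn_integral_eq_integral[OF intW] W0 by simp
  have intB: "integrable P B"
    unfolding B_def using int intW by auto
  have "(\<integral>x. B x \<partial>P) = (\<integral>x. L x \<partial>P) + 1 - (\<integral>x. W x \<partial>P)"
    unfolding B_def using int intW by (simp add: P.prob_space)
  then have B: "(\<integral>x. L x \<partial>P) \<le> (\<integral>x. B x \<partial>P)" using W2 by simp
  \<comment> \<open>Here \<open>ln (W x) = L x - ln (h x)\<close> and \<open>D x = ln (h x)\<close>,
    so the bound on \<open>ln (W x)\<close> rearranges to the claim.\<close>
  have BD: "AE x in P. B x \<le> D x"
    using pos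
  proof eventually_elim
    case (elim x)
    have "ln (W x) \<le> W x - 1"
      using elim by (intro ln_le_minus_one) (simp add: W_def)
    then show ?case
      using elim by (simp add: W_def B_def D_def entropy_density_def log_def ln_div h_def f_def)
  qed
  \<comment> \<open>The integrable minorant \<open>B\<close> bounds the negative part of
    \<open>D\<close>, which rules out the form \<infinity> - \<infinity>. Either the positive part
    is infinite and so is the entropy, or \<open>D\<close> is integrable and monotonicity of the
    integral applies.\<close>
  have "(\<integral>\<^sup>+x. ennreal (- D x) \<partial>P) \<le> (\<integral>\<^sup>+x. ennreal (- B x) \<partial>P)"
    using BD by (intro nn_integral_mono_AE, eventually_elim) (auto intro: ennreal_leI)
  also have "\<dots> < \<infinity>"
    using intB by (auto simp: real_integrable_def top.not_eq_extremum)
  finally have neg: "(\<integral>\<^sup>+x. ennreal (- D x) \<partial>P) < \<infinity>" .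
  show ?thesis
  proof (cases "(\<integral>\<^sup>+x. ennreal (D x) \<partial>P) = \<infinity>")
    case True
    then show ?thesis
      using ac neg by (cases "\<integral>\<^sup>+x. ennreal (- D x) \<partial>P") (auto simp: rel_entropy_def D_def)
  next
    case False
    then have intD: "integrable P D"
      using neg by (auto simp: real_integrable_def)
    have "(\<integral>x. B x \<partial>P) \<le> (\<integral>x. D x \<partial>P)"
      by (rule integral_mono_AE[OF intB intD BD])
    then show ?thesis
      using B rel_entropy_eq_integral[OF ac] intD by (simp add: D_def)
  qed
qed

section \<open>Product densities on Euclidean space\<close>

lemma measurable_vec_lambda:
  fixes M :: "'n::finite \<Rightarrow> real measure"
  assumes [measurable_cong]: "\<And>i. sets (M i) = sets borel"
  shows "vec_lambda \<in> Pi\<^sub>M UNIV M \<rightarrow>\<^sub>M (borel :: (real ^ 'n) measure)"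
  by (subst borel_measurable_euclidean_space) (auto simp: Basis_vec_def inner_axis)

text \<open>Lebesgue measure is determined by its values on boxes, and \<open>vec_lambda\<close>
  pulls a box back to a product of intervals.\<close>

lemma lborel_vec_eq_distr_PiM:
  "(lborel :: (real ^ 'n) measure) = distr (\<Pi>\<^sub>M i\<in>UNIV. lborel) borel vec_lambda"
proof (rule lborel_eqI)
  interpret product_sigma_finite "\<lambda>i::'n. lborel :: real measure" by standard
  fix l u :: "real ^ 'n"
  assume le: "\<And>b. b \<in> Basis \<Longrightarrow> l \<bullet> b \<le> u \<bullet> b"
  have le': "l $ i \<le> u $ i" for i
    using le[of "axis i 1"] by (auto simp: Basis_vec_def inner_axis)
  have [measurable]: "vec_lambda \<in> (\<Pi>\<^sub>M i\<in>UNIV. (lborel :: real measure)) \<rightarrow>\<^sub>M (borel :: (real ^ 'n) measure)"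
    by (rule measurable_vec_lambda) simp
  have "vec_lambda -` box l u \<inter> space (\<Pi>\<^sub>M i\<in>UNIV. lborel) = (\<Pi>\<^sub>E i\<in>UNIV. {l $ i<..<u $ i})"
    by (auto simp: space_PiM mem_box_cart PiE_iff)
  then have "emeasure (distr (\<Pi>\<^sub>M i\<in>UNIV. lborel) borel vec_lambda) (box l u)
      = (\<Prod>i\<in>UNIV. emeasure lborel {l $ i<..<u $ i})"
    by (simp add: emeasure_distr emeasure_PiM)
  also have "\<dots> = (\<Prod>i\<in>UNIV. (u - l) $ i)"
    using le' by (simp add: prod_ennreal)
  also have "(\<Prod>i\<in>UNIV. (u - l) $ i) = (\<Prod>b\<in>Basis. (u - l) \<bullet> b)"
    \<comment> \<open>The basis vectors are the \<open>axis i 1\<close>; the choice operator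
      recovers the index from the vector.\<close>
    by (rule prod.reindex_bij_witness[of _ "\<lambda>b. SOME i. b = axis i 1" "\<lambda>i. axis i 1"])
       (auto simp: Basis_vec_def inner_axis axis_eq_axis)
  finally show "emeasure (distr (\<Pi>\<^sub>M i\<in>UNIV. lborel) borel vec_lambda) (box l u)
      = ennreal (\<Prod>b\<in>Basis. (u - l) \<bullet> b)" .
qed simp

text \<open>A product measure is determined by its values on rectangles. There the integrand splits
  into one factor per coordinate, and the integral of the product is the product of the
  integrals.\<close>

lemma PiM_density:
  assumes "finite I" and M: "\<And>i. sigma_finite_measure (M i)"
    and [measurable]: "\<And>i. f i \<in> borel_measurable (M i)"
    and fM: "\<And>i. sigma_finite_measure (density (M i) (f i))"
  shows "(\<Pi>\<^sub>M i\<in>I. density (M i) (f i)) = density (\<Pi>\<^sub>M i\<in>I. M i) (\<lambda>x. \<Prod>i\<in>I. f i (x i))"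
proof -
  interpret M: product_sigma_finite M using M by (simp add: product_sigma_finite_def)
  interpret D: product_sigma_finite "\<lambda>i. density (M i) (f i)"
    using fM by (simp add: product_sigma_finite_def)
  show ?thesis
  proof (rule D.PiM_eqI[symmetric])
    show "sets (density (Pi\<^sub>M I M) (\<lambda>x. \<Prod>i\<in>I. f i (x i))) = sets (\<Pi>\<^sub>M i\<in>I. density (M i) (f i))"
      by (simp cong: sets_PiM_cong)
    fix A assume "\<And>i. i \<in> I \<Longrightarrow> A i \<in> sets (density (M i) (f i))"
    then have A[measurable]: "\<And>i. i \<in> I \<Longrightarrow> A i \<in> sets (M i)" by simp
    have [measurable]: "Pi\<^sub>E I A \<in> sets (Pi\<^sub>M I M)"
      using A \<open>finite I\<close> by (intro sets_PiM_I_finite)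
    have "emeasure (density (Pi\<^sub>M I M) (\<lambda>x. \<Prod>i\<in>I. f i (x i))) (Pi\<^sub>E I A)
        = (\<integral>\<^sup>+x. (\<Prod>i\<in>I. f i (x i)) * indicator (Pi\<^sub>E I A) x \<partial>Pi\<^sub>M I M)"
      by (rule emeasure_density) measurable
    also have "\<dots> = (\<integral>\<^sup>+x. (\<Prod>i\<in>I. f i (x i) * indicator (A i) (x i)) \<partial>Pi\<^sub>M I M)"
    proof (rule nn_integral_cong)
      fix x assume "x \<in> space (Pi\<^sub>M I M)"
      then have "indicator (Pi\<^sub>E I A) x = (\<Prod>i\<in>I. indicator (A i) (x i) :: ennreal)"
        using \<open>finite I\<close>
        by (auto simp: indicator_def space_PiM PiE_iff intro!: prod.neutral)
      then show "(\<Prod>i\<in>I. f i (x i)) * indicator (Pi\<^sub>E I A) x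
          = (\<Prod>i\<in>I. f i (x i) * indicator (A i) (x i))"
        by (simp add: prod.distrib)
    qed
    also have "\<dots> = (\<Prod>i\<in>I. \<integral>\<^sup>+x. f i x * indicator (A i) x \<partial>M i)"
      using \<open>finite I\<close> by (intro M.product_nn_integral_prod) measurable
    also have "\<dots> = (\<Prod>i\<in>I. emeasure (density (M i) (f i)) (A i))"
      by (intro prod.cong refl emeasure_density[symmetric]) auto
    finally show "emeasure (density (Pi\<^sub>M I M) (\<lambda>x. \<Prod>i\<in>I. f i (x i))) (Pi\<^sub>E I A)
        = (\<Prod>i\<in>I. emeasure (density (M i) (f i)) (A i))" .
  qed fact
qed

text \<open>Serves to turn the joint law of independent coordinates into a density on
  \<open>real ^ 'n\<close>: Lebesgue measure is itself an image under \<open>vec_lambda\<close>, and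
  a density on an image measure pulls back along the map.\<close>

lemma distr_PiM_density_vec:
  fixes f :: "'n::finite \<Rightarrow> real \<Rightarrow> ennreal"
  assumes f[measurable]: "\<And>i. f i \<in> borel_measurable borel"
    and "\<And>i. sigma_finite_measure (density lborel (f i))"
  shows "distr (\<Pi>\<^sub>M i\<in>UNIV. density lborel (f i)) borel vec_lambda
      = density lborel (\<lambda>x :: real ^ 'n. \<Prod>i\<in>UNIV. f i (x $ i))"
proof -
  have [measurable]: "vec_lambda \<in> (\<Pi>\<^sub>M i\<in>UNIV. (lborel :: real measure)) \<rightarrow>\<^sub>M (borel :: (real ^ 'n) measure)"
    by (rule measurable_vec_lambda) simp
  have "(\<Pi>\<^sub>M i\<in>UNIV. density lborel (f i))
      = density (\<Pi>\<^sub>M i\<in>UNIV. lborel) (\<lambda>x. \<Prod>i\<in>UNIV. f i (x i))"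
    using assms by (intro PiM_density) (auto intro: lborel.sigma_finite_measure_axioms)
  then show ?thesis
    by (subst lborel_vec_eq_distr_PiM) (simp add: density_distr)
qed

section \<open>Centred Gaussian densities and their ratios\<close>

lemma matrix_inv_eqI:
  fixes A B :: "'a::semiring_1 ^ 'n ^ 'n"
  assumes "A ** B = mat 1" and "B ** A = mat 1"
  shows "matrix_inv A = B"
proof -
  \<comment> \<open>\<open>matrix_inv\<close> is a choice among two-sided inverses, and
    \<open>B\<close> witnesses that one exists.\<close>
  have "A ** matrix_inv A = mat 1 \<and> matrix_inv A ** A = mat 1"
    unfolding matrix_inv_def by (rule someI[of _ B]) (use assms in simp)
  then have "matrix_inv A = (B ** A) ** matrix_inv A" "B = B ** (A ** matrix_inv A)"
    using assms by simp_all
  then show ?thesis by (simp add: matrix_mul_assoc)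
qed

text \<open>For a scalar covariance the quadratic form is a sum of squares and the determinant a
  power, so the density factorises.\<close>

lemma gaussian_scaled_identity:
  fixes s :: real
  assumes "s > 0"
  shows "gaussian 0 (s\<^sup>2 *\<^sub>R mat 1 :: real ^ 'n ^ 'n)
    = density lborel (\<lambda>x. ennreal (\<Prod>i\<in>UNIV. normal_density 0 s (x $ i)))"
proof -
  let ?C = "s\<^sup>2 *\<^sub>R mat 1 :: real ^ 'n ^ 'n"
  have "?C ** ((1 / s\<^sup>2) *\<^sub>R mat 1) = mat 1" "((1 / s\<^sup>2) *\<^sub>R mat 1) ** ?C = mat 1"
    using assms by (simp_all add: matrix_scalar_ac flip: scalar_matrix_assoc)
  then have inv: "matrix_inv ?C = (1 / s\<^sup>2) *\<^sub>R mat 1"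
    by (rule matrix_inv_eqI)
  have det: "det ?C = (s\<^sup>2) ^ CARD('n)"
    by (subst det_diagonal) (auto simp: mat_def)
  have "exp (- (x \<bullet> (matrix_inv ?C *v x)) / 2) / sqrt ((2 * pi) ^ CARD('n) * det ?C)
      = (\<Prod>i\<in>UNIV. normal_density 0 s (x $ i))" for x :: "real ^ 'n"
  proof -
    have "matrix_inv ?C *v x = (1 / s\<^sup>2) *\<^sub>R x"
      by (simp add: inv scaleR_matrix_vector_assoc[symmetric])
    then have "- (x \<bullet> (matrix_inv ?C *v x)) / 2 = (\<Sum>i\<in>UNIV. - (x $ i)\<^sup>2 / (2 * s\<^sup>2))"
      by (simp add: inner_vec_def power2_eq_square sum_divide_distrib sum_negf mult.commute)
    moreover have "sqrt ((2 * pi) ^ CARD('n) * det ?C) = sqrt (2 * pi * s\<^sup>2) ^ CARD('n)"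
      by (simp add: det real_sqrt_power power_mult_distrib real_sqrt_mult)
    ultimately show ?thesis
      by (simp add: normal_density_def exp_sum prod_dividef)
  qed
  then show ?thesis by (simp add: gaussian_def)
qed

text \<open>The exponent is the one-coordinate log-likelihood ratio: half the difference of the
  inverse variances times \<open>x\<^sup>2\<close>, plus the logarithm
  \<open>ln (s / sqrt v)\<close> of the ratio of normalising constants.\<close>

lemma normal_density_ratio:
  fixes s v x :: real
  assumes "s > 0" "v > 0"
  shows "normal_density 0 (sqrt v) x
    = normal_density 0 s x * exp ((1 / s\<^sup>2 - 1 / v) / 2 * x\<^sup>2 - ln (v / s\<^sup>2) / 2)"
proof -
  have "ln (v / s\<^sup>2) / 2 = ln (sqrt v / s)"
    using assms by (simp add: ln_div ln_sqrt ln_realpow)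
  then have factor: "exp (c - ln (v / s\<^sup>2) / 2) = exp c * (s / sqrt v)" for c
    using assms by (simp add: exp_diff)
  have "- x\<^sup>2 / (2 * v) = - x\<^sup>2 / (2 * s\<^sup>2) + (1 / s\<^sup>2 - 1 / v) / 2 * x\<^sup>2"
    by (simp add: diff_divide_distrib left_diff_distrib)
  then have "exp (- x\<^sup>2 / (2 * v)) = exp (- x\<^sup>2 / (2 * s\<^sup>2)) * exp ((1 / s\<^sup>2 - 1 / v) / 2 * x\<^sup>2)"
    by (simp only: exp_add)
  then show ?thesis
    unfolding normal_density_def factor using assms by (simp add: real_sqrt_mult)
qed

section \<open>The lower bound and the equality case\<close>

theorem lemma4:
  fixes M :: "'a measure"
    and R :: "'a \<Rightarrow> real ^ 'n"
    and \<sigma>\<^sub>0 :: real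
    and P \<rho> :: "'n \<Rightarrow> real"
    and Q\<^sub>0 :: "(real ^ 'n) measure"
  assumes "\<sigma>\<^sub>0\<^sup>2 > 0"
    and "Q\<^sub>0 = gaussian 0 (\<sigma>\<^sub>0\<^sup>2 *\<^sub>R mat 1)"
    and "prob_space M"
    and "R \<in> borel_measurable M"
    and "\<And>t. integrable M (\<lambda>\<omega>. (R \<omega> $ t)\<^sup>2)"
    and "\<And>t. prob_space.expectation M (\<lambda>\<omega>. R \<omega> $ t) = 0"
    and "\<And>t. P t \<ge> 0"
    and "\<And>t. prob_space.variance M (\<lambda>\<omega>. R \<omega> $ t) = \<sigma>\<^sub>0\<^sup>2 + P t"
    and "\<And>t. \<rho> t = P t / \<sigma>\<^sub>0\<^sup>2"
  shows "rel_entropy (distr M borel R) Q\<^sub>0 \<ge> ereal (1 / 2 * (\<Sum>t\<in>UNIV. \<rho> t - ln (1 + \<rho> t)))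
    \<and> (prob_space.indep_vars M (\<lambda>_. borel) (\<lambda>t \<omega>. R \<omega> $ t) UNIV
        \<and> (\<forall>t. distributed M lborel (\<lambda>\<omega>. R \<omega> $ t) (normal_density 0 (sqrt (\<sigma>\<^sub>0\<^sup>2 + P t))))
       \<longrightarrow> rel_entropy (distr M borel R) Q\<^sub>0 = ereal (1 / 2 * (\<Sum>t\<in>UNIV. \<rho> t - ln (1 + \<rho> t))))"
proof -
  interpret prob_space M by fact
  note [measurable] = assms(4)
  \<comment> \<open>The sign of \<open>\<sigma>\<^sub>0\<close> is free, while the normal density
    calls for a positive standard deviation.\<close>
  define s where "s = \<bar>\<sigma>\<^sub>0\<bar>"
  have s: "s > 0" "\<sigma>\<^sub>0\<^sup>2 = s\<^sup>2" using assms(1) by (auto simp: s_def)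
  define v where "v t = \<sigma>\<^sub>0\<^sup>2 + P t" for t
  have v: "v t > 0" for t using assms(1) assms(7)[of t] by (simp add: v_def add_pos_nonneg)
  define \<nu> where "\<nu> t = normal_density 0 (sqrt (v t))" for t
  define L where "L x = (\<Sum>t\<in>UNIV. (1 / s\<^sup>2 - 1 / v t) / 2 * (x $ t)\<^sup>2 - ln (v t / s\<^sup>2) / 2)"
    for x :: "real ^ 'n"
  have [measurable]: "\<nu> t \<in> borel_measurable borel" for t by (simp add: \<nu>_def)
  have [measurable]: "L \<in> borel_measurable borel" unfolding L_def by measurable
  have prob_\<nu>: "prob_space (density lborel (\<nu> t))" for t
    unfolding \<nu>_def using v by (intro prob_space_normal_density) simp

  \<comment> \<open>The Gaussian product law with variances \<open>v t\<close>. Its form as a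
    density gives the likelihood ratio \<open>exp L\<close> against \<open>Q\<^sub>0\<close>; its
    form as an image of a product measure gives total mass 1 and, later, the law of \<open>R\<close>
    in the independent case.\<close>
  define Q\<^sub>1 where "Q\<^sub>1 = density lborel (\<lambda>x :: real ^ 'n. \<Prod>t\<in>UNIV. ennreal (\<nu> t (x $ t)))"
  have Q1_distr: "distr (\<Pi>\<^sub>M t\<in>UNIV. density lborel (\<nu> t)) borel vec_lambda = Q\<^sub>1"
    unfolding Q\<^sub>1_def
    by (intro distr_PiM_density_vec)
       (auto intro: prob_space_imp_sigma_finite prob_\<nu>)
  have vec_meas: "vec_lambda \<in> (\<Pi>\<^sub>M t\<in>UNIV. density lborel (\<nu> t)) \<rightarrow>\<^sub>M (borel :: (real ^ 'n) measure)"
    by (rule measurable_vec_lambda) simp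
  have prob_Q1: "prob_space Q\<^sub>1"
    unfolding Q1_distr[symmetric]
    by (intro prob_space.prob_space_distr prob_space_PiM prob_\<nu> vec_meas)

  have Q0: "Q\<^sub>0 = density lborel (\<lambda>x. ennreal (\<Prod>t\<in>UNIV. normal_density 0 s (x $ t)))"
    using gaussian_scaled_identity[OF s(1)] assms(2) s(2) by simp
  have Q1_Q0: "Q\<^sub>1 = density Q\<^sub>0 (\<lambda>x. ennreal (exp (L x)))"
  proof -
    have "(\<Prod>t\<in>UNIV. ennreal (\<nu> t (x $ t)))
        = ennreal (\<Prod>t\<in>UNIV. normal_density 0 s (x $ t)) * ennreal (exp (L x))" for x
    proof -
      have "(\<Prod>t\<in>UNIV. \<nu> t (x $ t)) = (\<Prod>t\<in>UNIV. normal_density 0 s (x $ t)) * exp (L x)"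
        unfolding \<nu>_def normal_density_ratio[OF s(1) v] L_def
        by (simp only: exp_sum[OF finite] prod.distrib)
      then show ?thesis
        by (simp add: prod_ennreal \<nu>_def prod_nonneg flip: ennreal_mult)
    qed
    then show ?thesis
      unfolding Q0 Q\<^sub>1_def by (subst density_density_eq) auto
  qed
  have setsQ0[measurable_cong]: "sets Q\<^sub>0 = sets borel" by (simp add: Q0)
  have sf_Q0: "sigma_finite_measure Q\<^sub>0"
    unfolding Q0
    by (subst sigma_finite_measure.sigma_finite_iff_density_finite[OF lborel.sigma_finite_measure_axioms])
       auto
  \<comment> \<open>The integral is the total mass of \<open>Q\<^sub>1\<close>.\<close>
  have mass: "(\<integral>\<^sup>+x. ennreal (exp (L x)) \<partial>Q\<^sub>0) \<le> 1"
  proof -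
    have "(\<integral>\<^sup>+x. ennreal (exp (L x)) \<partial>Q\<^sub>0) = emeasure Q\<^sub>1 (space Q\<^sub>1)"
      unfolding Q1_Q0 by (subst emeasure_density) (auto intro!: nn_integral_cong)
    then show ?thesis using prob_space.emeasure_space_1[OF prob_Q1] by simp
  qed

  \<comment> \<open>As the means are zero, variances are second moments.\<close>
  have sq: "(\<integral>\<omega>. (R \<omega> $ t)\<^sup>2 \<partial>M) = v t" for t
    using assms(6,8)[of t] by (simp add: v_def)
  have summand: "integrable M (\<lambda>\<omega>. c * (R \<omega> $ t)\<^sup>2 - d)" for c d t
    by (intro Bochner_Integration.integrable_diff integrable_mult_right assms(5)) simp
  have intL: "integrable (distr M borel R) L"
    unfolding L_def
    by (subst integrable_distr_eq) (auto simp del: times_divide_eq_left intro!: summand)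
  have "(\<integral>x. L x \<partial>distr M borel R) = (\<integral>\<omega>. L (R \<omega>) \<partial>M)"
    by (rule integral_distr) auto
  also have "\<dots> = (\<Sum>t\<in>UNIV. (1 / s\<^sup>2 - 1 / v t) / 2 * v t - ln (v t / s\<^sup>2) / 2)"
    unfolding L_def
    by (subst Bochner_Integration.integral_sum[OF summand])
       (simp add: assms(5) sq prob_space del: times_divide_eq_left)
  also have "\<dots> = 1 / 2 * (\<Sum>t\<in>UNIV. \<rho> t - ln (1 + \<rho> t))"
    unfolding sum_distrib_left
  \<comment> \<open>Since v/s^2 = 1 + \<rho>, the quadratic term contributes \<rho>/2 and the
    constant term -ln(1 + \<rho>)/2.\<close>
  proof (intro sum.cong refl)
    fix t
    have "v t / s\<^sup>2 = 1 + \<rho> t" using s by (simp add: v_def assms(9) field_simps)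
    moreover have "(1 / s\<^sup>2 - 1 / v t) / 2 * v t = (v t / s\<^sup>2 - 1) / 2"
      using v[of t] by (simp add: field_simps)
    ultimately show "(1 / s\<^sup>2 - 1 / v t) / 2 * v t - ln (v t / s\<^sup>2) / 2 = 1 / 2 * (\<rho> t - ln (1 + \<rho> t))"
      by simp
  qed
  finally have value_L: "(\<integral>x. L x \<partial>distr M borel R) = 1 / 2 * (\<Sum>t\<in>UNIV. \<rho> t - ln (1 + \<rho> t))" .

  have "ereal (\<integral>x. L x \<partial>distr M borel R) \<le> rel_entropy (distr M borel R) Q\<^sub>0"
    using sf_Q0 setsQ0 mass intL by (intro rel_entropy_ge_integral prob_space_distr) auto
  moreover have "rel_entropy (distr M borel R) Q\<^sub>0 = ereal (\<integral>x. L x \<partial>distr M borel R)"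
    if indep: "indep_vars (\<lambda>_. borel) (\<lambda>t \<omega>. R \<omega> $ t) UNIV"
      and normal: "\<And>t. distributed M lborel (\<lambda>\<omega>. R \<omega> $ t) (normal_density 0 (sqrt (\<sigma>\<^sub>0\<^sup>2 + P t)))"
  proof -
    have marg: "distr M borel (\<lambda>\<omega>. R \<omega> $ t) = density lborel (\<nu> t)" for t
      using distributed_distr_eq_density[OF normal[of t]]
      by (simp add: \<nu>_def v_def cong: distr_cong)
    have [measurable]: "(\<lambda>\<omega>. R \<omega> $ t) \<in> borel_measurable M" for t
      by (rule measurable_compose[OF assms(4)]) measurable
    have [measurable]: "vec_lambda \<in> (\<Pi>\<^sub>M t\<in>UNIV. borel) \<rightarrow>\<^sub>M (borel :: (real ^ 'n) measure)"
      by (rule measurable_vec_lambda) simp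
    \<comment> \<open>Independence makes the joint law the product of the marginals; reassembling
      the coordinates with \<open>vec_lambda\<close> identifies the law of \<open>R\<close> with
      \<open>Q\<^sub>1\<close>, whose density against \<open>Q\<^sub>0\<close> is
      \<open>exp L\<close>.\<close>
    have "distr M (\<Pi>\<^sub>M t\<in>UNIV. borel) (\<lambda>\<omega>. \<lambda>t\<in>UNIV. R \<omega> $ t) = (\<Pi>\<^sub>M t\<in>UNIV. density lborel (\<nu> t))"
      using indep by (subst (asm) indep_vars_iff_distr_eq_PiM) (auto simp: marg)
    then have "Q\<^sub>1 = distr (distr M (\<Pi>\<^sub>M t\<in>UNIV. borel) (\<lambda>\<omega>. \<lambda>t\<in>UNIV. R \<omega> $ t)) borel vec_lambda"
      using Q1_distr by simp
    also have "\<dots> = distr M borel R"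
      by (subst distr_distr) (auto simp: comp_def vec_eq_iff intro!: distr_cong)
    finally have "distr M borel R = density Q\<^sub>0 (\<lambda>x. ennreal (exp (L x)))"
      using Q1_Q0 by simp
    then show ?thesis
      using sf_Q0 intL by (intro rel_entropy_exp_density) measurable
  qed
  ultimately show ?thesis
    unfolding value_L by blast
qed

end
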